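(* For every integer $k\ge1$ and every second-order formula $H\in\mathcal{L}^{(2)}_{x,D}$, $$k\Sigma_0\models choice_h^{1,1}(H).$$
   Context: Language: second-order formulas (the set $\mathcal{L}^{(2)}$) are built from individual variables, $n$-ary predicate variables for each $n\ge1$ ("variables of sort $n$"), identity between individuals, connectives, and quantifiers over individual variables and over predicate variables of every sort. $\mathcal{L}^{(2)}_{x,D}$ is the set of formulas $H=H(x,D)$ in which the individual variable $x$ and the unary predicate variable $D$ occur only free (i.e. not bound); $H$ may contain further free individual and predicate variables. Structures: for a non-empty set $I$, an $n$-ary predicate on $I$ is a function $\alpha:I^n\to\{true,false\}$, identified with a subset of $I^n$. A predicate structure over $I$ is a sequence $\Sigma=(J_n)_{n\ge0}$ with $J_0=I$ and each $J_n$ ($n\ge1$) a non-empty set of $n$-ary predicates on $I$. Individual variables range over $J_0$ and predicate variables of sort $n$ range over $J_n$ (Henkin semantics). An assignment maps each variable to an element of the corresponding domain. $\Sigma\models\varphi$ means that $\varphi$ is true in $\Sigma$ under every assignment. The model $k\Sigma_0$: let $I=\{1,\dots,k\}\times\mathbb{N}$, $I_j=\{j\}\times\mathbb{N}$, and let $\mathfrak{G}$ be the group of all permutations $\pi$ of $I$ with $\pi(\xi)\in I_j$ for all $j\in\{1,\dots,k\}$ and all $\xi\in I_j$. For $\pi\in\mathfrak{G}$ let $\alpha^\pi$ be the image predicate, $\alpha^\pi(\pi(\xi_1),\dots,\pi(\xi_n))=\alpha(\xi_1,\dots,\xi_n)$. Then $k\Sigma_0=(J_n)_{n\ge0}$ with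 $J_0=I$ and, for $n\ge1$, $J_n$ the set of all $n$-ary predicates $\alpha$ on $I$ for which there is a finite $P\subseteq I$ such that $\alpha^\pi=\alpha$ for every $\pi\in\mathfrak{G}$ fixing every element of $P$. Ackermann axioms: for $H\in\mathcal{L}^{(2)}_{x,D}$, $$choice_h^{1,1}(H)=\ \forall x\,\exists D\,H(x,D)\to\exists S\,\forall x\,\exists D\,\big(\forall y(Dy\leftrightarrow Sxy)\land H(x,D)\big),$$ where $S$ is a binary predicate variable not occurring in $H$. *)

theory Defs
  imports Main "HOL-Combinatorics.Permutations"
begin

text \<open>Individual variables are natural numbers; \<open>(n, i)\<close> with \<open>n \<ge> 1\<close> is the \<open>i\<close>-th predicate
  variable of sort \<open>n\<close>.  Variables are named (rather than de Bruijn) because the class of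
  formulas \<open>L2_xD\<close> below refers to the bound occurrences of particular variables.\<close>

type_synonym ivar = nat
type_synonym pvar = "nat \<times> nat"

datatype form =
    Eq ivar ivar
  | Atom pvar "ivar list"
  | Neg form
  | Conj form form
  | Disj form form
  | Imp form form
  | Iff form form
  | All ivar form
  | Ex ivar form
  | PAll pvar form
  | PEx pvar form

primrec wf_form :: "form \<Rightarrow> bool" where
  "wf_form (Eq u v) \<longleftrightarrow> True"
| "wf_form (Atom A us) \<longleftrightarrow> fst A \<ge> 1 \<and> length us = fst A"
| "wf_form (Neg F) \<longleftrightarrow> wf_form F"
| "wf_form (Conj F G) \<longleftrightarrow> wf_form F \<and> wf_form G"
| "wf_form (Disj F G) \<longleftrightarrow> wf_form F \<and> wf_form G"
| "wf_form (Imp F G) \<longleftrightarrow> wf_form F \<and> wf_form G"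
| "wf_form (Iff F G) \<longleftrightarrow> wf_form F \<and> wf_form G"
| "wf_form (All u F) \<longleftrightarrow> wf_form F"
| "wf_form (Ex u F) \<longleftrightarrow> wf_form F"
| "wf_form (PAll A F) \<longleftrightarrow> fst A \<ge> 1 \<and> wf_form F"
| "wf_form (PEx A F) \<longleftrightarrow> fst A \<ge> 1 \<and> wf_form F"

definition L2 :: "form set" where
  "L2 = {F. wf_form F}"

primrec bound_ivars :: "form \<Rightarrow> ivar set" where
  "bound_ivars (Eq u v) = {}"
| "bound_ivars (Atom A us) = {}"
| "bound_ivars (Neg F) = bound_ivars F"
| "bound_ivars (Conj F G) = bound_ivars F \<union> bound_ivars G"
| "bound_ivars (Disj F G) = bound_ivars F \<union> bound_ivars G"
| "bound_ivars (Imp F G) = bound_ivars F \<union> bound_ivars G"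
| "bound_ivars (Iff F G) = bound_ivars F \<union> bound_ivars G"
| "bound_ivars (All u F) = insert u (bound_ivars F)"
| "bound_ivars (Ex u F) = insert u (bound_ivars F)"
| "bound_ivars (PAll A F) = bound_ivars F"
| "bound_ivars (PEx A F) = bound_ivars F"

primrec bound_pvars :: "form \<Rightarrow> pvar set" where
  "bound_pvars (Eq u v) = {}"
| "bound_pvars (Atom A us) = {}"
| "bound_pvars (Neg F) = bound_pvars F"
| "bound_pvars (Conj F G) = bound_pvars F \<union> bound_pvars G"
| "bound_pvars (Disj F G) = bound_pvars F \<union> bound_pvars G"
| "bound_pvars (Imp F G) = bound_pvars F \<union> bound_pvars G"
| "bound_pvars (Iff F G) = bound_pvars F \<union> bound_pvars G"
| "bound_pvars (All u F) = bound_pvars F"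
| "bound_pvars (Ex u F) = bound_pvars F"
| "bound_pvars (PAll A F) = insert A (bound_pvars F)"
| "bound_pvars (PEx A F) = insert A (bound_pvars F)"

text \<open>All predicate variables occurring in a formula, free or bound.\<close>

primrec pvars :: "form \<Rightarrow> pvar set" where
  "pvars (Eq u v) = {}"
| "pvars (Atom A us) = {A}"
| "pvars (Neg F) = pvars F"
| "pvars (Conj F G) = pvars F \<union> pvars G"
| "pvars (Disj F G) = pvars F \<union> pvars G"
| "pvars (Imp F G) = pvars F \<union> pvars G"
| "pvars (Iff F G) = pvars F \<union> pvars G"
| "pvars (All u F) = pvars F"
| "pvars (Ex u F) = pvars F"
| "pvars (PAll A F) = insert A (pvars F)"
| "pvars (PEx A F) = insert A (pvars F)"

text \<open>The unary predicate variable \<open>D\<close> is given by its index.  As usual for the notation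
  \<open>H(x,D)\<close>, neither \<open>x\<close> nor \<open>D\<close> is required to actually occur in \<open>H\<close>; a (possibly vacuous)
  quantifier over \<open>x\<close> or \<open>D\<close> counts as a bound occurrence.\<close>

definition L2_xD :: "ivar \<Rightarrow> nat \<Rightarrow> form set" where
  "L2_xD x D = {H \<in> L2. x \<notin> bound_ivars H \<and> (1, D) \<notin> bound_pvars H}"

text \<open>An \<open>n\<close>-ary predicate on \<open>I\<close> is a set of lists of length \<open>n\<close> over \<open>I\<close>.  The domain \<open>J\<^sub>0\<close>
  is the field \<open>indivs\<close>; the value of \<open>preds\<close> at \<open>0\<close> is irrelevant.\<close>

type_synonym 'a predicate = "'a list set"

record 'a pred_structure =
  indivs :: "'a set"
  preds :: "nat \<Rightarrow> 'a predicate set"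

definition nary_predicates :: "'a set \<Rightarrow> nat \<Rightarrow> 'a predicate set" where
  "nary_predicates I n = Pow {xs. length xs = n \<and> set xs \<subseteq> I}"

definition predicate_structure :: "'a pred_structure \<Rightarrow> bool" where
  "predicate_structure \<Sigma> \<longleftrightarrow> indivs \<Sigma> \<noteq> {} \<and>
     (\<forall>n\<ge>1. preds \<Sigma> n \<noteq> {} \<and> preds \<Sigma> n \<subseteq> nary_predicates (indivs \<Sigma>) n)"

definition assignment :: "'a pred_structure \<Rightarrow> (ivar \<Rightarrow> 'a) \<Rightarrow> (pvar \<Rightarrow> 'a predicate) \<Rightarrow> bool" where
  "assignment \<Sigma> e p \<longleftrightarrow>
     (\<forall>u. e u \<in> indivs \<Sigma>) \<and> (\<forall>n\<ge>1. \<forall>i. p (n, i) \<in> preds \<Sigma> n)"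

primrec sat :: "'a pred_structure \<Rightarrow> (ivar \<Rightarrow> 'a) \<Rightarrow> (pvar \<Rightarrow> 'a predicate) \<Rightarrow> form \<Rightarrow> bool" where
  "sat \<Sigma> e p (Eq u v) \<longleftrightarrow> e u = e v"
| "sat \<Sigma> e p (Atom A us) \<longleftrightarrow> map e us \<in> p A"
| "sat \<Sigma> e p (Neg F) \<longleftrightarrow> \<not> sat \<Sigma> e p F"
| "sat \<Sigma> e p (Conj F G) \<longleftrightarrow> sat \<Sigma> e p F \<and> sat \<Sigma> e p G"
| "sat \<Sigma> e p (Disj F G) \<longleftrightarrow> sat \<Sigma> e p F \<or> sat \<Sigma> e p G"
| "sat \<Sigma> e p (Imp F G) \<longleftrightarrow> (sat \<Sigma> e p F \<longrightarrow> sat \<Sigma> e p G)"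
| "sat \<Sigma> e p (Iff F G) \<longleftrightarrow> (sat \<Sigma> e p F \<longleftrightarrow> sat \<Sigma> e p G)"
| "sat \<Sigma> e p (All u F) \<longleftrightarrow> (\<forall>a\<in>indivs \<Sigma>. sat \<Sigma> (e(u := a)) p F)"
| "sat \<Sigma> e p (Ex u F) \<longleftrightarrow> (\<exists>a\<in>indivs \<Sigma>. sat \<Sigma> (e(u := a)) p F)"
| "sat \<Sigma> e p (PAll A F) \<longleftrightarrow> (\<forall>\<alpha>\<in>preds \<Sigma> (fst A). sat \<Sigma> e (p(A := \<alpha>)) F)"
| "sat \<Sigma> e p (PEx A F) \<longleftrightarrow> (\<exists>\<alpha>\<in>preds \<Sigma> (fst A). sat \<Sigma> e (p(A := \<alpha>)) F)"

definition models :: "'a pred_structure \<Rightarrow> form \<Rightarrow> bool" (infix "\<Turnstile>" 50) where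
  "\<Sigma> \<Turnstile> F \<longleftrightarrow> (\<forall>e p. assignment \<Sigma> e p \<longrightarrow> sat \<Sigma> e p F)"

definition block :: "nat \<Rightarrow> (nat \<times> nat) set" where
  "block j = {j} \<times> UNIV"

definition k_indivs :: "nat \<Rightarrow> (nat \<times> nat) set" where
  "k_indivs k = {1..k} \<times> UNIV"

definition k_group :: "nat \<Rightarrow> (nat \<times> nat \<Rightarrow> nat \<times> nat) set" where
  "k_group k = {\<pi>. \<pi> permutes k_indivs k \<and> (\<forall>j\<in>{1..k}. \<forall>\<xi>\<in>block j. \<pi> \<xi> \<in> block j)}"

text \<open>With predicates as sets of tuples, \<open>\<alpha>\<^sup>\<pi>\<close> is an image; \<open>image_predicate_apply\<close> below is the usual
  defining equation.\<close>

definition image_predicate :: "('a \<Rightarrow> 'a) \<Rightarrow> 'a predicate \<Rightarrow> 'a predicate" where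
  "image_predicate \<pi> \<alpha> = map \<pi> ` \<alpha>"

definition k_Sigma0 :: "nat \<Rightarrow> (nat \<times> nat) pred_structure" where
  "k_Sigma0 k =
     \<lparr>indivs = k_indivs k,
      preds = (\<lambda>n. {\<alpha> \<in> nary_predicates (k_indivs k) n.
        \<exists>P. finite P \<and> P \<subseteq> k_indivs k \<and>
          (\<forall>\<pi>\<in>k_group k. (\<forall>\<xi>\<in>P. \<pi> \<xi> = \<xi>) \<longrightarrow> image_predicate \<pi> \<alpha> = \<alpha>)})\<rparr>"

lemma image_predicate_apply:
  assumes "inj \<pi>"
  shows "map \<pi> xs \<in> image_predicate \<pi> \<alpha> \<longleftrightarrow> xs \<in> \<alpha>"
  using assms by (auto simp: image_predicate_def)

lemma predicate_structure_k_Sigma0: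
  assumes "k \<ge> 1"
  shows "predicate_structure (k_Sigma0 k)"
proof -
  have "{} \<in> preds (k_Sigma0 k) n" for n
    by (auto simp: k_Sigma0_def nary_predicates_def image_predicate_def)
  then have "preds (k_Sigma0 k) n \<noteq> {}" for n
    by blast
  moreover have "preds (k_Sigma0 k) n \<subseteq> nary_predicates (indivs (k_Sigma0 k)) n" for n
    by (auto simp: k_Sigma0_def)
  moreover have "indivs (k_Sigma0 k) \<noteq> {}"
    using assms by (auto simp: k_Sigma0_def k_indivs_def)
  ultimately show ?thesis
    by (simp add: predicate_structure_def)
qed

text \<open>\<open>D\<close> and \<open>S\<close> are the indices of a unary and of a binary predicate variable.  The side
  conditions \<open>y \<noteq> x\<close> and \<open>(2, S) \<notin> pvars H\<close> are imposed where the axiom is used.\<close>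

definition choice_h11 :: "ivar \<Rightarrow> nat \<Rightarrow> ivar \<Rightarrow> nat \<Rightarrow> form \<Rightarrow> form" where
  "choice_h11 x D y S H =
     Imp (All x (PEx (1, D) H))
         (PEx (2, S) (All x (PEx (1, D)
            (Conj (All y (Iff (Atom (1, D) [y]) (Atom (2, S) [x, y]))) H))))"

end

theory Submission imports Defs begin

text \<open>Let \<open>P\<close> be a finite set that contains the individual parameters of \<open>H\<close> and supports its
  predicate parameters.  Under the pointwise stabilizer of \<open>P\<close>, every individual \<open>a\<close> is moved to
  one of finitely many representatives \<open>r a\<close> by the transposition \<open>(r a  a)\<close>.  Choose \<open>E (r a)\<close>
  as a witness of \<open>H\<close> at each representative only, and carry it over to \<open>a\<close> by this transposition; truth
  of \<open>H\<close> is preserved.  If \<open>\<sigma>\<close> fixes \<open>P\<close>, the representatives, and supports of the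
  finitely many sets \<open>E (r a)\<close>, then \<open>\<sigma> (r a  a) \<sigma>\<inverse> = (r a  \<sigma> a)\<close> and \<open>r (\<sigma> a) = r a\<close>, so \<open>\<sigma>\<close> preserves
  the resulting binary relation.\<close>

section \<open>Dependence of truth on the assignment, and invariance under automorphisms\<close>

primrec ivars :: "form \<Rightarrow> ivar set" where
  "ivars (Eq u v) = {u, v}"
| "ivars (Atom A us) = set us"
| "ivars (Neg F) = ivars F"
| "ivars (Conj F G) = ivars F \<union> ivars G"
| "ivars (Disj F G) = ivars F \<union> ivars G"
| "ivars (Imp F G) = ivars F \<union> ivars G"
| "ivars (Iff F G) = ivars F \<union> ivars G"
| "ivars (All u F) = insert u (ivars F)"
| "ivars (Ex u F) = insert u (ivars F)"
| "ivars (PAll A F) = ivars F"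
| "ivars (PEx A F) = ivars F"

lemma finite_ivars: "finite (ivars F)"
  by (induction F) auto

lemma finite_pvars: "finite (pvars F)"
  by (induction F) auto

lemma wf_form_sort_pvars: "wf_form F \<Longrightarrow> A \<in> pvars F \<Longrightarrow> fst A \<ge> 1"
  by (induction F) auto

text \<open>Used to identify transported assignments with the intended ones on \<open>H\<close>, and
  to discard the value of \<open>S\<close>. A quantifier updates both assignments by the same value,
  so agreement survives the induction.\<close>

lemma sat_cong:
  assumes "\<And>u. u \<in> ivars F \<Longrightarrow> e u = e' u" "\<And>A. A \<in> pvars F \<Longrightarrow> p A = p' A"
  shows "sat \<Sigma> e p F \<longleftrightarrow> sat \<Sigma> e' p' F"
  using assms
proof (induction F arbitrary: e e' p p')
  case (Atom A us)
  then have "map e us = map e' us" by (intro map_cong) auto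
  with Atom show ?case by (simp only: sat.simps pvars.simps singletonI)
next
  case (Neg F)
  from Neg.IH[of e e' p p'] Neg.prems show ?case by simp
next
  case (Conj F G)
  from Conj.IH(1)[of e e' p p'] Conj.IH(2)[of e e' p p'] Conj.prems show ?case by simp
next
  case (Disj F G)
  from Disj.IH(1)[of e e' p p'] Disj.IH(2)[of e e' p p'] Disj.prems show ?case by simp
next
  case (Imp F G)
  from Imp.IH(1)[of e e' p p'] Imp.IH(2)[of e e' p p'] Imp.prems show ?case by simp
next
  case (Iff F G)
  from Iff.IH(1)[of e e' p p'] Iff.IH(2)[of e e' p p'] Iff.prems show ?case by simp
next
  case (All u F)
  have "sat \<Sigma> (e(u := a)) p F \<longleftrightarrow> sat \<Sigma> (e'(u := a)) p' F" for a
    by (rule All.IH) (use All.prems in auto)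
  then show ?case by simp
next
  case (Ex u F)
  have "sat \<Sigma> (e(u := a)) p F \<longleftrightarrow> sat \<Sigma> (e'(u := a)) p' F" for a
    by (rule Ex.IH) (use Ex.prems in auto)
  then show ?case by simp
next
  case (PAll A F)
  have "sat \<Sigma> e (p(A := \<alpha>)) F \<longleftrightarrow> sat \<Sigma> e' (p'(A := \<alpha>)) F" for \<alpha>
    by (rule PAll.IH) (use PAll.prems in auto)
  then show ?case by simp
next
  case (PEx A F)
  have "sat \<Sigma> e (p(A := \<alpha>)) F \<longleftrightarrow> sat \<Sigma> e' (p'(A := \<alpha>)) F" for \<alpha>
    by (rule PEx.IH) (use PEx.prems in auto)
  then show ?case by simp
qed simp

text \<open>Since \<pi> maps each quantifier domain onto itself, a quantifier over the domain can be
  reindexed as one over its image; injectivity settles identities and atoms.\<close>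

lemma sat_automorphism:
  assumes "inj \<pi>" and ind: "\<pi> ` indivs \<Sigma> = indivs \<Sigma>"
    and pred: "\<And>n. image_predicate \<pi> ` preds \<Sigma> n = preds \<Sigma> n"
  shows "sat \<Sigma> (\<pi> \<circ> e) (image_predicate \<pi> \<circ> p) F \<longleftrightarrow> sat \<Sigma> e p F"
proof (induction F arbitrary: e p)
  case (Eq u v)
  then show ?case using \<open>inj \<pi>\<close> by (simp add: inj_eq)
next
  case (Atom A us)
  then show ?case
    using image_predicate_apply[OF \<open>inj \<pi>\<close>, of "map e us" "p A"] by (simp add: comp_def)
next
  case (All u F)
  have IH: "sat \<Sigma> ((\<pi> \<circ> e)(u := \<pi> a)) (image_predicate \<pi> \<circ> p) F \<longleftrightarrow> sat \<Sigma> (e(u := a)) p F" for a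
    using All.IH[of "e(u := a)" p] by (simp only: fun_upd_comp)
  have "sat \<Sigma> (\<pi> \<circ> e) (image_predicate \<pi> \<circ> p) (All u F) \<longleftrightarrow>
      (\<forall>b\<in>\<pi> ` indivs \<Sigma>. sat \<Sigma> ((\<pi> \<circ> e)(u := b)) (image_predicate \<pi> \<circ> p) F)"
    by (simp only: sat.simps ind)
  then show ?case
    by (simp only: ball_simps IH sat.simps)
next
  case (Ex u F)
  have IH: "sat \<Sigma> ((\<pi> \<circ> e)(u := \<pi> a)) (image_predicate \<pi> \<circ> p) F \<longleftrightarrow> sat \<Sigma> (e(u := a)) p F" for a
    using Ex.IH[of "e(u := a)" p] by (simp only: fun_upd_comp)
  have "sat \<Sigma> (\<pi> \<circ> e) (image_predicate \<pi> \<circ> p) (Ex u F) \<longleftrightarrow>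
      (\<exists>b\<in>\<pi> ` indivs \<Sigma>. sat \<Sigma> ((\<pi> \<circ> e)(u := b)) (image_predicate \<pi> \<circ> p) F)"
    by (simp only: sat.simps ind)
  then show ?case
    by (simp only: bex_simps IH sat.simps)
next
  case (PAll A F)
  have IH: "sat \<Sigma> (\<pi> \<circ> e) ((image_predicate \<pi> \<circ> p)(A := image_predicate \<pi> \<alpha>)) F
      \<longleftrightarrow> sat \<Sigma> e (p(A := \<alpha>)) F" for \<alpha>
    using PAll.IH[of e "p(A := \<alpha>)"] by (simp only: fun_upd_comp)
  have "sat \<Sigma> (\<pi> \<circ> e) (image_predicate \<pi> \<circ> p) (PAll A F) \<longleftrightarrow>
      (\<forall>\<beta>\<in>image_predicate \<pi> ` preds \<Sigma> (fst A).
        sat \<Sigma> (\<pi> \<circ> e) ((image_predicate \<pi> \<circ> p)(A := \<beta>)) F)"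
    by (simp only: sat.simps pred)
  then show ?case
    by (simp only: ball_simps IH sat.simps)
next
  case (PEx A F)
  have IH: "sat \<Sigma> (\<pi> \<circ> e) ((image_predicate \<pi> \<circ> p)(A := image_predicate \<pi> \<alpha>)) F
      \<longleftrightarrow> sat \<Sigma> e (p(A := \<alpha>)) F" for \<alpha>
    using PEx.IH[of e "p(A := \<alpha>)"] by (simp only: fun_upd_comp)
  have "sat \<Sigma> (\<pi> \<circ> e) (image_predicate \<pi> \<circ> p) (PEx A F) \<longleftrightarrow>
      (\<exists>\<beta>\<in>image_predicate \<pi> ` preds \<Sigma> (fst A).
        sat \<Sigma> (\<pi> \<circ> e) ((image_predicate \<pi> \<circ> p)(A := \<beta>)) F)"
    by (simp only: sat.simps pred)
  then show ?case
    by (simp only: bex_simps IH sat.simps)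
qed simp_all

section \<open>The block-preserving group, finite supports, and the action on the model\<close>

lemma k_group_iff:
  "\<pi> \<in> k_group k \<longleftrightarrow> \<pi> permutes k_indivs k \<and> (\<forall>\<xi>\<in>k_indivs k. fst (\<pi> \<xi>) = fst \<xi>)"
proof -
  have "(\<forall>j\<in>{1..k}. \<forall>\<xi>\<in>block j. \<pi> \<xi> \<in> block j) \<longleftrightarrow> (\<forall>\<xi>\<in>k_indivs k. fst (\<pi> \<xi>) = fst \<xi>)"
    by (auto simp: block_def k_indivs_def mem_Times_iff)
  then show ?thesis by (simp add: k_group_def)
qed

lemma k_group_permutes: "\<pi> \<in> k_group k \<Longrightarrow> \<pi> permutes k_indivs k"
  by (simp add: k_group_iff)

lemma k_group_inv: "\<pi> \<in> k_group k \<Longrightarrow> inv \<pi> \<in> k_group k"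
  unfolding k_group_iff
  by (metis permutes_inv permutes_in_image permutes_inverses(1))

lemma k_group_comp: "\<pi> \<in> k_group k \<Longrightarrow> \<sigma> \<in> k_group k \<Longrightarrow> \<pi> \<circ> \<sigma> \<in> k_group k"
  unfolding k_group_iff by (auto simp: permutes_compose permutes_in_image)

lemma transpose_in_k_group:
  "a \<in> k_indivs k \<Longrightarrow> b \<in> k_indivs k \<Longrightarrow> fst a = fst b \<Longrightarrow> transpose a b \<in> k_group k"
  unfolding k_group_iff by (auto simp: permutes_swap_id transpose_def)

text \<open>The notion of support from permutation models: invariance under the pointwise stabilizer
  of \<open>P\<close>. Finiteness of \<open>P\<close> is stated separately.\<close>

definition k_supports :: "nat \<Rightarrow> (nat \<times> nat) set \<Rightarrow> (nat \<times> nat) predicate \<Rightarrow> bool" where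
  "k_supports k P \<alpha> \<longleftrightarrow>
     (\<forall>\<pi>\<in>k_group k. (\<forall>\<xi>\<in>P. \<pi> \<xi> = \<xi>) \<longrightarrow> image_predicate \<pi> \<alpha> = \<alpha>)"

lemma k_supportsD:
  "k_supports k P \<alpha> \<Longrightarrow> \<pi> \<in> k_group k \<Longrightarrow> (\<And>\<xi>. \<xi> \<in> P \<Longrightarrow> \<pi> \<xi> = \<xi>) \<Longrightarrow> image_predicate \<pi> \<alpha> = \<alpha>"
  by (simp add: k_supports_def)

lemma indivs_k_Sigma0: "indivs (k_Sigma0 k) = k_indivs k"
  by (simp add: k_Sigma0_def)

lemma preds_k_Sigma0_iff:
  "\<alpha> \<in> preds (k_Sigma0 k) n \<longleftrightarrow> \<alpha> \<in> nary_predicates (k_indivs k) n \<and>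
     (\<exists>P. finite P \<and> P \<subseteq> k_indivs k \<and> k_supports k P \<alpha>)"
  by (simp add: k_Sigma0_def k_supports_def)

lemma image_predicate_comp:
  "image_predicate \<pi> (image_predicate \<sigma> \<alpha>) = image_predicate (\<pi> \<circ> \<sigma>) \<alpha>"
  by (simp add: image_predicate_def image_image)

lemma image_predicate_id: "image_predicate id \<alpha> = \<alpha>"
  by (simp add: image_predicate_def)

lemma image_predicate_inv:
  "\<pi> \<in> k_group k \<Longrightarrow> image_predicate \<pi> (image_predicate (inv \<pi>) \<alpha>) = \<alpha>"
  by (simp add: image_predicate_comp image_predicate_id permutes_inv_o(1)[OF k_group_permutes])

text \<open>The pointwise stabilizer is closed under inverses: applying \<pi> to the inclusion for
  \<open>inv \<pi>\<close> gives the reverse inclusion.\<close>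

lemma k_supportsI:
  assumes sub: "\<And>\<pi>. \<pi> \<in> k_group k \<Longrightarrow> (\<And>\<xi>. \<xi> \<in> P \<Longrightarrow> \<pi> \<xi> = \<xi>) \<Longrightarrow> image_predicate \<pi> \<alpha> \<subseteq> \<alpha>"
  shows "k_supports k P \<alpha>"
  unfolding k_supports_def
proof (intro ballI impI)
  fix \<pi> assume \<pi>: "\<pi> \<in> k_group k" and fix_P: "\<forall>\<xi>\<in>P. \<pi> \<xi> = \<xi>"
  have "inv \<pi> \<xi> = \<xi>" if "\<xi> \<in> P" for \<xi>
    using fix_P that permutes_inverses(2)[OF k_group_permutes[OF \<pi>], of \<xi>] by simp
  then have "image_predicate (inv \<pi>) \<alpha> \<subseteq> \<alpha>"
    using sub k_group_inv[OF \<pi>] by blast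
  then have "image_predicate \<pi> (image_predicate (inv \<pi>) \<alpha>) \<subseteq> image_predicate \<pi> \<alpha>"
    by (auto simp: image_predicate_def)
  then have "\<alpha> \<subseteq> image_predicate \<pi> \<alpha>"
    by (simp add: image_predicate_inv[OF \<pi>])
  moreover have "image_predicate \<pi> \<alpha> \<subseteq> \<alpha>"
    using sub \<pi> fix_P by blast
  ultimately show "image_predicate \<pi> \<alpha> = \<alpha>" by blast
qed

lemma image_predicate_in_preds:
  assumes \<pi>: "\<pi> \<in> k_group k" and \<alpha>: "\<alpha> \<in> preds (k_Sigma0 k) n"
  shows "image_predicate \<pi> \<alpha> \<in> preds (k_Sigma0 k) n"
proof -
  note perm = k_group_permutes[OF \<pi>]
  obtain P where P: "finite P" "P \<subseteq> k_indivs k" "k_supports k P \<alpha>"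
    using \<alpha> by (auto simp: preds_k_Sigma0_iff)
  have "image_predicate \<pi> \<alpha> \<in> nary_predicates (k_indivs k) n"
    using \<alpha> permutes_in_image[OF perm]
    by (fastforce simp: preds_k_Sigma0_iff nary_predicates_def image_predicate_def)
  moreover have "k_supports k (\<pi> ` P) (image_predicate \<pi> \<alpha>)"
    unfolding k_supports_def
  proof (intro ballI impI)
    fix \<sigma> assume \<sigma>: "\<sigma> \<in> k_group k" and fix_P: "\<forall>\<xi>\<in>\<pi> ` P. \<sigma> \<xi> = \<xi>"
    have "image_predicate (inv \<pi> \<circ> (\<sigma> \<circ> \<pi>)) \<alpha> = \<alpha>"
      using P(3) fix_P
      by (intro k_supportsD[where P = P])
        (auto intro!: k_group_comp k_group_inv \<pi> \<sigma> simp: permutes_inverses[OF perm])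
    then have "image_predicate \<pi> (image_predicate (inv \<pi>) (image_predicate \<sigma> (image_predicate \<pi> \<alpha>)))
        = image_predicate \<pi> \<alpha>"
      by (simp add: image_predicate_comp)
    then show "image_predicate \<sigma> (image_predicate \<pi> \<alpha>) = image_predicate \<pi> \<alpha>"
      by (simp add: image_predicate_inv[OF \<pi>])
  qed
  moreover have "\<pi> ` P \<subseteq> k_indivs k"
    using P(2) permutes_in_image[OF perm] by auto
  ultimately show ?thesis
    using P(1) by (auto simp: preds_k_Sigma0_iff)
qed

text \<open>Group elements are automorphisms; every \<alpha> is attained as the image of its
  translate under \<open>inv \<pi>\<close>.\<close>

lemma sat_k_group:
  assumes "\<pi> \<in> k_group k"
  shows "sat (k_Sigma0 k) (\<pi> \<circ> e) (image_predicate \<pi> \<circ> p) F \<longleftrightarrow> sat (k_Sigma0 k) e p F"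
proof (rule sat_automorphism)
  note perm = k_group_permutes[OF assms]
  show "inj \<pi>" using perm by (rule permutes_inj)
  show "\<pi> ` indivs (k_Sigma0 k) = indivs (k_Sigma0 k)"
    using permutes_image[OF perm] by (simp add: indivs_k_Sigma0)
  fix n
  show "image_predicate \<pi> ` preds (k_Sigma0 k) n = preds (k_Sigma0 k) n" (is "?L = ?R")
  proof
    show "?L \<subseteq> ?R" using image_predicate_in_preds[OF assms] by blast
    show "?R \<subseteq> ?L"
    proof
      fix \<alpha> assume "\<alpha> \<in> ?R"
      then have "image_predicate (inv \<pi>) \<alpha> \<in> ?R"
        using image_predicate_in_preds k_group_inv[OF assms] by blast
      then show "\<alpha> \<in> ?L"
        using image_predicate_inv[OF assms, of \<alpha>] by (metis imageI)
    qed
  qed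
qed

section \<open>Choice on orbit representatives, spread by transpositions\<close>

theorem proposition4p2:
  fixes k :: nat and x y :: ivar and D S :: nat and H :: form
  assumes "k \<ge> 1"
    and "H \<in> L2_xD x D"
    and "y \<noteq> x"
    and "(2, S) \<notin> pvars H"
  shows "k_Sigma0 k \<Turnstile> choice_h11 x D y S H"
proof -
  let ?\<Sigma> = "k_Sigma0 k" and ?I = "k_indivs k"
  have "sat ?\<Sigma> e p (choice_h11 x D y S H)" if asg: "assignment ?\<Sigma> e p" for e p
  proof -
    \<comment> \<open>The semantic content of the axiom, with \<open>S\<close> already removed from
      the assignment under which \<open>H\<close> is evaluated.\<close>
    have choice: "\<exists>\<alpha>\<in>preds ?\<Sigma> 2. \<forall>a\<in>?I. \<exists>\<beta>\<in>preds ?\<Sigma> 1.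
        (\<forall>b\<in>?I. [b] \<in> \<beta> \<longleftrightarrow> [a, b] \<in> \<alpha>) \<and> sat ?\<Sigma> (e(x := a)) (p((1, D) := \<beta>)) H"
      if "\<forall>a\<in>?I. \<exists>\<beta>\<in>preds ?\<Sigma> 1. sat ?\<Sigma> (e(x := a)) (p((1, D) := \<beta>)) H"
    proof -
      \<comment> \<open>Choice in the metatheory. The supports of all the \<open>E a\<close>
        together may be infinite, so \<open>E\<close> cannot serve directly as the relation.\<close>
      from that obtain E where E: "\<And>a. a \<in> ?I \<Longrightarrow> E a \<in> preds ?\<Sigma> 1"
          "\<And>a. a \<in> ?I \<Longrightarrow> sat ?\<Sigma> (e(x := a)) (p((1, D) := E a)) H"
        by metis
      have "\<exists>P. finite P \<and> P \<subseteq> ?I \<and> k_supports k P (p A)" if "A \<in> pvars H" for A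
      proof -
        \<comment> \<open>\<open>assignment\<close> constrains \<open>p\<close> only at sorts from 1
          on.\<close>
        have "fst A \<ge> 1"
          by (rule wf_form_sort_pvars[of H]) (use that assms(2) in \<open>auto simp: L2_xD_def L2_def\<close>)
        then have "p A \<in> preds ?\<Sigma> (fst A)"
          using asg by (cases A) (auto simp: assignment_def)
        then show ?thesis by (auto simp: preds_k_Sigma0_iff)
      qed
      then obtain supp where supp: "\<And>A. A \<in> pvars H \<Longrightarrow>
          finite (supp A) \<and> supp A \<subseteq> ?I \<and> k_supports k (supp A) (p A)"
        by metis
      have "\<exists>P. finite P \<and> P \<subseteq> ?I \<and> k_supports k P (E a)" if "a \<in> ?I" for a
        using E(1)[OF that] by (auto simp: preds_k_Sigma0_iff)
      then obtain suppE where suppE: "\<And>a. a \<in> ?I \<Longrightarrow>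
          finite (suppE a) \<and> suppE a \<subseteq> ?I \<and> k_supports k (suppE a) (E a)"
        by metis
      \<comment> \<open>Values at all occurring variables, free or bound, are collected; this
        contains the parameters and is still finite.\<close>
      define P where "P = e ` ivars H \<union> (\<Union>A\<in>pvars H. supp A)"
      have "finite P"
        using supp by (auto simp: P_def finite_ivars finite_pvars)
      have "P \<subseteq> ?I"
        using supp asg by (auto simp: P_def assignment_def indivs_k_Sigma0)
      \<comment> \<open>A single \<open>m\<close> for which \<open>(j, m)\<close> lies outside
        \<open>P\<close> in every block \<open>j\<close>.\<close>
      obtain m where m: "m \<notin> snd ` P"
        using ex_new_if_finite[OF infinite_UNIV_nat finite_imageI[OF \<open>finite P\<close>]] by blast
      define r where "r a = (if a \<in> P then a else (fst a, m))" for a :: "nat \<times> nat"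
      define R where "R = r ` ?I"
      \<comment> \<open>Besides points of \<open>P\<close>, there is at most one representative per
        block.\<close>
      have "R \<subseteq> P \<union> {1..k} \<times> {m}"
        by (auto simp: R_def r_def k_indivs_def)
      then have "finite R"
        by (rule finite_subset) (simp add: \<open>finite P\<close>)
      have r_I: "r a \<in> ?I" if "a \<in> ?I" for a
        using that by (auto simp: r_def k_indivs_def)
      then have "R \<subseteq> ?I" by (auto simp: R_def)
      \<comment> \<open>For \<open>a\<close> in \<open>P\<close> the transposition is the identity;
        otherwise both \<open>a\<close> and \<open>r a\<close> lie outside \<open>P\<close>.\<close>
      have r_P: "transpose (r a) a \<xi> = \<xi>" if "\<xi> \<in> P" for a \<xi>
        using that m by (force simp: r_def transpose_def)
      have r_group: "transpose (r a) a \<in> k_group k" if "a \<in> ?I" for a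
        using that r_I by (intro transpose_in_k_group) (auto simp: r_def)
      have r_invariant: "r (\<sigma> a) = r a"
        if "\<sigma> \<in> k_group k" "\<And>\<xi>. \<xi> \<in> P \<Longrightarrow> \<sigma> \<xi> = \<xi>" "a \<in> ?I" for \<sigma> a
      proof (cases "a \<in> P")
        case False
        \<comment> \<open>Injectivity keeps the complement of \<open>P\<close> invariant; as
          \<sigma> also preserves blocks, the representative is unchanged.\<close>
        have "\<sigma> a \<notin> P"
        proof
          assume "\<sigma> a \<in> P"
          then have "\<sigma> (\<sigma> a) = \<sigma> a" by (rule that(2))
          then have "\<sigma> a = a"
            using permutes_inj[OF k_group_permutes[OF that(1)]] by (simp add: inj_eq)
          with \<open>\<sigma> a \<in> P\<close> False show False by simp
        qed
        with False that show ?thesis by (simp add: r_def k_group_iff)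
      qed (simp add: that)
      define T where "T a = image_predicate (transpose (r a) a) (E (r a))" for a
      have T_preds: "T a \<in> preds ?\<Sigma> 1" if "a \<in> ?I" for a
        unfolding T_def using that by (intro image_predicate_in_preds r_group E r_I)
      have T_sat: "sat ?\<Sigma> (e(x := a)) (p((1, D) := T a)) H" if "a \<in> ?I" for a
      proof -
        let ?\<pi> = "transpose (r a) a"
        have "sat ?\<Sigma> (?\<pi> \<circ> e(x := r a)) (image_predicate ?\<pi> \<circ> p((1, D) := E (r a))) H"
          using E(2)[OF r_I[OF that]] by (simp only: sat_k_group[OF r_group[OF that]])
        \<comment> \<open>At \<open>x\<close> the transposition sends \<open>r a\<close> to
          \<open>a\<close>; every other value lies in \<open>P\<close> and is fixed.\<close>
        moreover have "(?\<pi> \<circ> e(x := r a)) u = (e(x := a)) u" if "u \<in> ivars H" for u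
          using r_P[of "e u" a] that by (auto simp: P_def)
        moreover have "(image_predicate ?\<pi> \<circ> p((1, D) := E (r a))) A = (p((1, D) := T a)) A"
          if "A \<in> pvars H" for A
        proof -
          have "\<xi> \<in> P" if "\<xi> \<in> supp A" for \<xi>
            using that \<open>A \<in> pvars H\<close> by (auto simp: P_def)
          then have "image_predicate ?\<pi> (p A) = p A"
            using supp[OF that] r_group[OF \<open>a \<in> ?I\<close>] r_P
            by (intro k_supportsD[where P = "supp A"]) blast+
          \<comment> \<open>At \<open>(1, D)\<close> the two sides agree by definition of
            \<open>T\<close>; elsewhere by invariance of \<open>p A\<close>.\<close>
          then show ?thesis by (simp add: T_def)
        qed
        ultimately show ?thesis
          by (simp only: sat_cong[of H "?\<pi> \<circ> e(x := r a)" "e(x := a)"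
              "image_predicate ?\<pi> \<circ> p((1, D) := E (r a))" "p((1, D) := T a)"])
      qed
      define \<alpha> where "\<alpha> = {[a, b] | a b. a \<in> ?I \<and> [b] \<in> T a}"
      define Q where "Q = P \<union> R \<union> (\<Union>c\<in>R. suppE c)"
      have "finite Q"
        using \<open>finite P\<close> \<open>finite R\<close> \<open>R \<subseteq> ?I\<close> suppE by (auto simp: Q_def)
      moreover have "Q \<subseteq> ?I"
        using \<open>P \<subseteq> ?I\<close> \<open>R \<subseteq> ?I\<close> suppE by (fastforce simp: Q_def)
      moreover have "\<alpha> \<in> nary_predicates ?I 2"
        using T_preds by (fastforce simp: \<alpha>_def nary_predicates_def preds_k_Sigma0_iff)
      moreover have "k_supports k Q \<alpha>"
      proof (rule k_supportsI)
        fix \<sigma> assume \<sigma>: "\<sigma> \<in> k_group k" and fix_Q: "\<And>\<xi>. \<xi> \<in> Q \<Longrightarrow> \<sigma> \<xi> = \<xi>"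
        note perm = k_group_permutes[OF \<sigma>]
        have "[\<sigma> a, \<sigma> b] \<in> \<alpha>" if a: "a \<in> ?I" and b: "[b] \<in> T a" for a b
        proof -
          obtain c where c: "[c] \<in> E (r a)" "b = transpose (r a) a c"
            using b by (auto simp: T_def image_predicate_def)
          have "r a \<in> R" using a by (simp add: R_def)
          have "image_predicate \<sigma> (E (r a)) = E (r a)"
            using suppE[OF r_I[OF a]] \<sigma> fix_Q \<open>r a \<in> R\<close>
            by (intro k_supportsD[where P = "suppE (r a)"]) (auto simp: Q_def)
          then have "[\<sigma> c] \<in> E (r a)"
            using c(1) by (force simp: image_predicate_def)
          moreover have "r (\<sigma> a) = r a"
            using \<sigma> fix_Q a by (intro r_invariant) (auto simp: Q_def)
          moreover have "\<sigma> (r a) = r a"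
            using fix_Q \<open>r a \<in> R\<close> by (simp add: Q_def)
          \<comment> \<open>The conjugation identity for transpositions, evaluated at
            \<open>\<sigma> c\<close>.\<close>
          moreover have "\<sigma> (transpose (r a) a c) = transpose (\<sigma> (r a)) (\<sigma> a) (\<sigma> c)"
            using permutes_inj[OF perm] by (auto simp: transpose_def inj_eq)
          ultimately have "r (\<sigma> a) = r a" "[\<sigma> c] \<in> E (r a)"
            "\<sigma> b = transpose (r a) (\<sigma> a) (\<sigma> c)"
            by (simp_all add: c(2))
          then have "[\<sigma> b] \<in> T (\<sigma> a)"
            by (force simp: T_def image_predicate_def)
          then show ?thesis
            using a permutes_in_image[OF perm] unfolding \<alpha>_def by blast
        qed
        then show "image_predicate \<sigma> \<alpha> \<subseteq> \<alpha>"
          by (force simp: \<alpha>_def image_predicate_def)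
      qed
      ultimately have "\<alpha> \<in> preds ?\<Sigma> 2"
        by (auto simp: preds_k_Sigma0_iff)
      moreover have "\<exists>\<beta>\<in>preds ?\<Sigma> 1. (\<forall>b\<in>?I. [b] \<in> \<beta> \<longleftrightarrow> [a, b] \<in> \<alpha>) \<and>
          sat ?\<Sigma> (e(x := a)) (p((1, D) := \<beta>)) H" if "a \<in> ?I" for a
      proof (intro bexI conjI)
        show "\<forall>b\<in>?I. [b] \<in> T a \<longleftrightarrow> [a, b] \<in> \<alpha>"
          using that unfolding \<alpha>_def by blast
      qed (use that T_preds T_sat in simp_all)
      ultimately show ?thesis by blast
    qed
    have H_S: "sat ?\<Sigma> e' (p((2, S) := \<alpha>, (1, D) := \<beta>)) H \<longleftrightarrow> sat ?\<Sigma> e' (p((1, D) := \<beta>)) H"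
      for e' \<alpha> \<beta>
      using assms(4) by (intro sat_cong) auto
    have "sat ?\<Sigma> e p (choice_h11 x D y S H) \<longleftrightarrow>
        ((\<forall>a\<in>?I. \<exists>\<beta>\<in>preds ?\<Sigma> 1. sat ?\<Sigma> (e(x := a)) (p((1, D) := \<beta>)) H) \<longrightarrow>
         (\<exists>\<alpha>\<in>preds ?\<Sigma> 2. \<forall>a\<in>?I. \<exists>\<beta>\<in>preds ?\<Sigma> 1.
            (\<forall>b\<in>?I. [b] \<in> \<beta> \<longleftrightarrow> [a, b] \<in> \<alpha>) \<and> sat ?\<Sigma> (e(x := a)) (p((1, D) := \<beta>)) H))"
      \<comment> \<open>Because \<open>y\<close> differs from \<open>x\<close>, assigning
        \<open>b\<close> to \<open>y\<close> leaves \<open>x\<close> at \<open>a\<close>, so the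
        atom for \<open>S\<close> reads \<open>[a, b] \<in> \<alpha>\<close>.\<close>
      using assms(3) by (simp add: choice_h11_def indivs_k_Sigma0 H_S[simplified])
    with choice show ?thesis by blast
  qed
  then show ?thesis by (simp add: models_def)
qed

end
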